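(* The subalgebra $U^{\vee}_q$ of $U_q(\mathfrak{sl}_2)$ is invariant under each of the maps $\tau$, $\dagger$, $\sigma$.
   Context: Algebras are associative with $1$, and a subalgebra has the same $1$ as the parent algebra. $\mathbb{F}$ is a field, $q\in\mathbb{F}$ is nonzero with $q^4\neq 1$, and $a\in\mathbb{F}$ is nonzero with $a^2\neq 1$. $U_q(\mathfrak{sl}_2)$ is the $\mathbb{F}$-algebra with generators $x,y^{\pm1},z$ and relations $yy^{-1}=y^{-1}y=1$, $$\frac{qxy-q^{-1}yx}{q-q^{-1}} = 1,\qquad \frac{qyz-q^{-1}zy}{q-q^{-1}} = 1,\qquad \frac{qzx-q^{-1}xz}{q-q^{-1}} = 1.$$ $U^\vee_q$ is the subalgebra of $U_q(\mathfrak{sl}_2)$ generated by $x,y^{-1},z$. An antiautomorphism of an algebra is an $\mathbb{F}$-linear bijection $\gamma$ of the algebra to itself with $(uv)^\gamma=v^\gamma u^\gamma$. $\tau$ is the unique antiautomorphism of $U_q(\mathfrak{sl}_2)$ that sends $x\mapsto z$, $y^{\pm1}\mapsto y^{\pm1}$, $z\mapsto x$. $\sigma$ is the unique automorphism of $U_q(\mathfrak{sl}_2)$ that sends $x\mapsto a^{-2}x+(1-a^{-2})y^{-1}$, $y^{\pm1}\mapsto y^{\pm1}$, $z\mapsto a^2z+(1-a^2)y^{-1}$. $\dagger$ is the composition: first apply $\tau$, then $\sigma$. *)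

theory Defs
  imports
    "HOL-Library.Poly_Mapping"
    "HOL-Library.FuncSet"
    "HOL-Algebra.Subrings"
    "HOL-Algebra.QuotRing"
    "HOL-Algebra.Module"
    "HOL-Algebra.Algebraic_Closure_Type"
begin

section \<open>Algebras over a field\<close>

text \<open>
  An algebra over the field \<open>'f\<close> (a type) is represented by a record of type
  \<open>('f, 'u) module\<close>, i.e. a ring together with a scalar multiplication. Multiplication is
  not assumed to be commutative, so the library locale \<open>algebra\<close>, which requires a
  commutative ring, does not apply.
\<close>

definition is_subalgebra :: "'u set \<Rightarrow> ('f, 'u) module \<Rightarrow> bool" where
  "is_subalgebra H A \<longleftrightarrow> subring H A \<and> (\<forall>c. \<forall>u\<in>H. c \<odot>\<^bsub>A\<^esub> u \<in> H)"

definition generated_subalgebra :: "('f, 'u) module \<Rightarrow> 'u set \<Rightarrow> 'u set" where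
  "generated_subalgebra A S = \<Inter> {H. is_subalgebra H A \<and> S \<subseteq> H}"

text \<open>
  Maps on an algebra are normalised to be \<open>undefined\<close> outside the carrier, so that
  uniqueness of a map on the algebra is uniqueness of a HOL function.
\<close>

definition linear_bijection :: "('f, 'u) module \<Rightarrow> ('u \<Rightarrow> 'u) \<Rightarrow> bool" where
  "linear_bijection A g \<longleftrightarrow>
     g \<in> extensional (carrier A) \<and>
     bij_betw g (carrier A) (carrier A) \<and>
     (\<forall>u\<in>carrier A. \<forall>v\<in>carrier A. g (u \<oplus>\<^bsub>A\<^esub> v) = g u \<oplus>\<^bsub>A\<^esub> g v) \<and>
     (\<forall>c. \<forall>u\<in>carrier A. g (c \<odot>\<^bsub>A\<^esub> u) = c \<odot>\<^bsub>A\<^esub> g u)"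

definition algebra_automorphism :: "('f, 'u) module \<Rightarrow> ('u \<Rightarrow> 'u) \<Rightarrow> bool" where
  "algebra_automorphism A g \<longleftrightarrow>
     linear_bijection A g \<and> g \<one>\<^bsub>A\<^esub> = \<one>\<^bsub>A\<^esub> \<and>
     (\<forall>u\<in>carrier A. \<forall>v\<in>carrier A. g (u \<otimes>\<^bsub>A\<^esub> v) = g u \<otimes>\<^bsub>A\<^esub> g v)"

definition algebra_antiautomorphism :: "('f, 'u) module \<Rightarrow> ('u \<Rightarrow> 'u) \<Rightarrow> bool" where
  "algebra_antiautomorphism A g \<longleftrightarrow>
     linear_bijection A g \<and>
     (\<forall>u\<in>carrier A. \<forall>v\<in>carrier A. g (u \<otimes>\<^bsub>A\<^esub> v) = g v \<otimes>\<^bsub>A\<^esub> g u)"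


section \<open>The free algebra on a set of letters\<close>

datatype 'g word = Word (letters: "'g list")

instantiation word :: (type) monoid_add
begin
definition zero_word :: "'a word" where "0 = Word []"
definition plus_word :: "'a word \<Rightarrow> 'a word \<Rightarrow> 'a word" where
  "v + w = Word (letters v @ letters w)"
instance by standard (simp_all add: zero_word_def plus_word_def)
end

text \<open>
  The monoid of words is written additively, because the product of \<open>Poly_Mapping\<close> is the
  convolution with respect to \<open>+\<close>. The type below with its ring structure from
  \<open>Poly_Mapping\<close> is thus the free associative algebra.
\<close>

type_synonym ('g, 'f) free_algebra = "'g word \<Rightarrow>\<^sub>0 'f"

definition letter :: "'g \<Rightarrow> ('g, 'f::field) free_algebra" where
  "letter g = Poly_Mapping.single (Word [g]) 1"

definition scalar :: "'f::field \<Rightarrow> ('g, 'f) free_algebra" where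
  "scalar c = Poly_Mapping.single 0 c"

text \<open>
  The algebra presented by the letters \<open>'g\<close> and the relations \<open>r = 0\<close> for \<open>r \<in> R\<close>:
  the quotient of the free algebra by the two-sided ideal generated by \<open>R\<close>.
\<close>

abbreviation free_ring :: "('g, 'f::field) free_algebra ring" where
  "free_ring \<equiv> ring_of_type_algebra"

definition presented_class ::
    "('g, 'f::field) free_algebra set \<Rightarrow> ('g, 'f) free_algebra \<Rightarrow> ('g, 'f) free_algebra set" where
  "presented_class R p = (Idl\<^bsub>free_ring\<^esub> R) +>\<^bsub>free_ring\<^esub> p"

definition presented_algebra ::
    "('g, 'f::field) free_algebra set \<Rightarrow> ('f, ('g, 'f) free_algebra set) module" where
  "presented_algebra R =
     (let Q = free_ring Quot (Idl\<^bsub>free_ring\<^esub> R)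
      in ring.extend Q (module.fields (\<lambda>c u. presented_class R (scalar c) \<otimes>\<^bsub>Q\<^esub> u)))"


section \<open>The algebra \<open>U\<^sub>q(sl\<^sub>2)\<close> in the equitable presentation\<close>

datatype gen = Gx | Gy | Gyinv | Gz

definition q_weyl :: "'f::field \<Rightarrow> gen \<Rightarrow> gen \<Rightarrow> (gen, 'f) free_algebra" where
  "q_weyl q g h =
     scalar (inverse (q - inverse q)) *
     (scalar q * letter g * letter h - scalar (inverse q) * letter h * letter g)"

definition Uq_relations :: "'f::field \<Rightarrow> (gen, 'f) free_algebra set" where
  "Uq_relations q =
     {letter Gy * letter Gyinv - 1, letter Gyinv * letter Gy - 1,
      q_weyl q Gx Gy - 1, q_weyl q Gy Gz - 1, q_weyl q Gz Gx - 1}"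

definition Uq :: "'f::field \<Rightarrow> ('f, (gen, 'f) free_algebra set) module" where
  "Uq q = presented_algebra (Uq_relations q)"

definition Uq_gen :: "'f::field \<Rightarrow> gen \<Rightarrow> (gen, 'f) free_algebra set" where
  "Uq_gen q g = presented_class (Uq_relations q) (letter g)"

definition Uq_vee :: "'f::field \<Rightarrow> (gen, 'f) free_algebra set set" where
  "Uq_vee q = generated_subalgebra (Uq q) {Uq_gen q Gx, Uq_gen q Gyinv, Uq_gen q Gz}"

definition tau ::
    "'f::field \<Rightarrow> (gen, 'f) free_algebra set \<Rightarrow> (gen, 'f) free_algebra set" where
  "tau q = (THE g. algebra_antiautomorphism (Uq q) g \<and>
     g (Uq_gen q Gx) = Uq_gen q Gz \<and>
     g (Uq_gen q Gy) = Uq_gen q Gy \<and>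
     g (Uq_gen q Gyinv) = Uq_gen q Gyinv \<and>
     g (Uq_gen q Gz) = Uq_gen q Gx)"

definition sigma ::
    "'f::field \<Rightarrow> 'f \<Rightarrow> (gen, 'f) free_algebra set \<Rightarrow> (gen, 'f) free_algebra set" where
  "sigma q a = (THE g. algebra_automorphism (Uq q) g \<and>
     g (Uq_gen q Gx) =
       (inverse (a^2) \<odot>\<^bsub>Uq q\<^esub> Uq_gen q Gx) \<oplus>\<^bsub>Uq q\<^esub> ((1 - inverse (a^2)) \<odot>\<^bsub>Uq q\<^esub> Uq_gen q Gyinv) \<and>
     g (Uq_gen q Gy) = Uq_gen q Gy \<and>
     g (Uq_gen q Gyinv) = Uq_gen q Gyinv \<and>
     g (Uq_gen q Gz) =
       (a^2 \<odot>\<^bsub>Uq q\<^esub> Uq_gen q Gz) \<oplus>\<^bsub>Uq q\<^esub> ((1 - a^2) \<odot>\<^bsub>Uq q\<^esub> Uq_gen q Gyinv))"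

definition dagger ::
    "'f::field \<Rightarrow> 'f \<Rightarrow> (gen, 'f) free_algebra set \<Rightarrow> (gen, 'f) free_algebra set" where
  "dagger q a = sigma q a \<circ> tau q"

end

theory Submission
  imports Defs
begin

text \<open>
  Substituting for the letters gives a homomorphism or antihomomorphism of the free algebra; it
  descends to the quotient as soon as it maps the relations into the ideal they generate. For
  \<open>\<tau>\<close> the relations are permuted. For \<open>\<sigma>\<close> and the last relation, multiplying the other two
  \<open>q\<close>-Weyl relations by \<open>y\<inverse>\<close> on both sides gives
  \<open>(q z y\<inverse> - q\<inverse> y\<inverse> z) / (q - q\<inverse>) = y\<inverse> y\<inverse>\<close> and the same for \<open>y\<inverse>, x\<close>, so the coefficients
  of \<open>y\<inverse> y\<inverse>\<close> cancel. Thus \<open>\<tau>\<close> and \<open>\<sigma>\<close> exist, with inverses \<open>\<tau>\<close> and \<open>\<sigma>\<close> for \<open>a\<inverse>\<close>, and are determined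
  by their values on the generators. An (anti)automorphism maps a generated subalgebra onto itself
  once the images and preimages of the generators lie in it.
\<close>

section \<open>The free algebra\<close>

lemma scalar_mult_single: "scalar c * Poly_Mapping.single w d = Poly_Mapping.single w (c * d)"
  by (simp add: scalar_def mult_single)

lemma scalar_mult: "scalar c * scalar d = scalar (c * d)"
  by (simp add: scalar_def mult_single)

lemma scalar_mult_left: "scalar c * (scalar d * p) = scalar (c * d) * p"
  by (simp add: scalar_mult flip: mult.assoc)

lemma scalar_add: "scalar (c + d) = scalar c + scalar d"
  by (simp add: scalar_def single_add)

lemma scalar_diff: "scalar (c - d) = scalar c - scalar d"
  by (simp add: scalar_def single_diff)

lemma scalar_uminus: "scalar (- c) = - scalar c"
  by (simp add: scalar_def single_uminus)

lemma scalar_0 [simp]: "scalar 0 = 0"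
  by (simp add: scalar_def)

lemma scalar_1 [simp]: "scalar 1 = 1"
  by (simp add: scalar_def)

text \<open>\<open>update_induct\<close> adds keys outside the support, and there updating is the
  same as adding a single term.\<close>

lemma free_algebra_single_induct [case_names single add]:
  fixes p :: "('g, 'f::field) free_algebra"
  assumes single: "\<And>w c. P (Poly_Mapping.single w c)"
    and add: "\<And>p r. P p \<Longrightarrow> P r \<Longrightarrow> P (p + r)"
  shows "P p"
proof (induction p rule: update_induct)
  case const
  then show ?case using single[of 0 0] by simp
next
  case (update p w c)
  have "Poly_Mapping.update w c p = p + Poly_Mapping.single w c"
    using update by (intro poly_mapping_eqI)
      (auto simp: lookup_update lookup_add lookup_single when_def in_keys_iff)
  with update single add show ?case by simp
qed

text \<open>The empty word is neutral for concatenation on both sides, and coefficients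
  commute.\<close>

lemma scalar_commute: "p * scalar c = scalar c * p"
  by (induction p rule: free_algebra_single_induct)
    (simp_all add: scalar_def mult_single distrib_left distrib_right mult.commute)

lemma scalar_left_commute: "p * (scalar c * r) = scalar c * (p * r)"
  by (metis mult.assoc scalar_commute)

lemma scalar_mult_scalar_mult: "(scalar c * p) * (scalar d * r) = scalar (c * d) * (p * r)"
  by (metis mult.assoc scalar_left_commute scalar_mult)

lemma single_Word_conv_letter:
  "Poly_Mapping.single (Word ls) c = scalar c * prod_list (map letter ls)"
proof -
  have "Poly_Mapping.single (Word ls) (1::'b) = prod_list (map letter ls)"
  proof (induction ls)
    case Nil
    then show ?case by (simp add: zero_word_def flip: single_one)
  next
    case (Cons l ls)
    have "Poly_Mapping.single (Word (l # ls)) (1::'b) = letter l * Poly_Mapping.single (Word ls) 1"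
      by (simp add: letter_def mult_single plus_word_def)
    then show ?case by (simp add: Cons.IH)
  qed
  then show ?thesis by (metis mult.right_neutral scalar_mult_single)
qed

lemma free_algebra_induct [case_names scalar letter add mult]:
  fixes p :: "('g, 'f::field) free_algebra"
  assumes scalar: "\<And>c. P (scalar c)"
    and letter: "\<And>l. P (letter l)"
    and add: "\<And>p r. P p \<Longrightarrow> P r \<Longrightarrow> P (p + r)"
    and mult: "\<And>p r. P p \<Longrightarrow> P r \<Longrightarrow> P (p * r)"
  shows "P p"
proof (induction p rule: free_algebra_single_induct)
  case (single w c)
  have "P (prod_list (map letter ls))" for ls
    using scalar[of 1] by (induction ls) (auto intro: letter mult)
  with scalar mult show ?case by (cases w) (simp add: single_Word_conv_letter)
qed (rule add)

section \<open>Linear extension from the basis of words, and substitution\<close>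

definition word_extension ::
    "('g word \<Rightarrow> ('h, 'f::field) free_algebra) \<Rightarrow> ('g, 'f) free_algebra \<Rightarrow> ('h, 'f) free_algebra"
  where "word_extension f p =
    (\<Sum>w\<in>Poly_Mapping.keys p. scalar (Poly_Mapping.lookup p w) * f w)"

text \<open>Gives \<open>p\<close>, \<open>r\<close> and \<open>p + r\<close> a common index set,
  although cancellation may shrink the support of the sum.\<close>

lemma word_extension_superset:
  assumes "finite A" "Poly_Mapping.keys p \<subseteq> A"
  shows "word_extension f p = (\<Sum>w\<in>A. scalar (Poly_Mapping.lookup p w) * f w)"
  unfolding word_extension_def using assms
  by (intro sum.mono_neutral_left) (auto simp: in_keys_iff)

lemma word_extension_add: "word_extension f (p + r) = word_extension f p + word_extension f r"
proof -
  let ?A = "Poly_Mapping.keys p \<union> Poly_Mapping.keys r"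
  have "Poly_Mapping.keys (p + r) \<subseteq> ?A" by (rule keys_add)
  then show ?thesis
    by (simp add: word_extension_superset[of ?A] lookup_add scalar_add distrib_right sum.distrib)
qed

lemma word_extension_single: "word_extension f (Poly_Mapping.single w c) = scalar c * f w"
  by (subst word_extension_superset[of "{w}"]) auto

text \<open>Both sides are additive in \<open>p\<close> and in \<open>r\<close>, so two nested
  inductions leave a product of two single terms.\<close>

lemma word_extension_mult:
  assumes "\<And>v w. f (v + w) = f v * f w"
  shows "word_extension f (p * r) = word_extension f p * word_extension f r"
proof (induction p rule: free_algebra_single_induct)
  case (single v c)
  show ?case
    by (induction r rule: free_algebra_single_induct)
      (simp_all add: mult_single word_extension_single assms distrib_left word_extension_add
        scalar_mult_scalar_mult)
qed (simp add: distrib_right word_extension_add)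

lemma word_extension_antimult:
  assumes "\<And>v w. f (v + w) = f w * f v"
  shows "word_extension f (p * r) = word_extension f r * word_extension f p"
proof (induction p rule: free_algebra_single_induct)
  case (single v c)
  show ?case
    by (induction r rule: free_algebra_single_induct)
      (simp_all add: mult_single word_extension_single assms distrib_left distrib_right
        word_extension_add scalar_mult_scalar_mult mult.commute)
qed (simp add: distrib_right distrib_left word_extension_add)

definition free_hom ::
    "('g \<Rightarrow> ('h, 'f::field) free_algebra) \<Rightarrow> ('g, 'f) free_algebra \<Rightarrow> ('h, 'f) free_algebra"
  where "free_hom s = word_extension (\<lambda>w. prod_list (map s (letters w)))"

text \<open>Reversing the list of images turns concatenation into the product in opposite order,
  with values in the free algebra itself rather than its opposite.\<close>

definition free_antihom ::
    "('g \<Rightarrow> ('h, 'f::field) free_algebra) \<Rightarrow> ('g, 'f) free_algebra \<Rightarrow> ('h, 'f) free_algebra"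
  where "free_antihom s = word_extension (\<lambda>w. prod_list (rev (map s (letters w))))"

lemma free_hom_add: "free_hom s (p + r) = free_hom s p + free_hom s r"
  by (simp add: free_hom_def word_extension_add)

lemma free_hom_mult: "free_hom s (p * r) = free_hom s p * free_hom s r"
  unfolding free_hom_def by (rule word_extension_mult) (simp add: plus_word_def)

lemma free_hom_scalar [simp]: "free_hom s (scalar c) = scalar c"
  by (simp add: free_hom_def word_extension_single scalar_def[of c] zero_word_def)

lemma free_hom_letter [simp]: "free_hom s (letter l) = s l"
  by (simp add: free_hom_def letter_def word_extension_single)

lemma free_antihom_add: "free_antihom s (p + r) = free_antihom s p + free_antihom s r"
  by (simp add: free_antihom_def word_extension_add)

lemma free_antihom_mult: "free_antihom s (p * r) = free_antihom s r * free_antihom s p"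
  unfolding free_antihom_def by (rule word_extension_antimult) (simp add: plus_word_def)

lemma free_antihom_scalar [simp]: "free_antihom s (scalar c) = scalar c"
  by (simp add: free_antihom_def word_extension_single scalar_def[of c] zero_word_def)

lemma free_antihom_letter [simp]: "free_antihom s (letter l) = s l"
  by (simp add: free_antihom_def letter_def word_extension_single)

section \<open>Presented algebras\<close>

lemma free_ring_simps [simp]:
  "carrier free_ring = UNIV"
  "x \<otimes>\<^bsub>free_ring\<^esub> y = x * y"
  "x \<oplus>\<^bsub>free_ring\<^esub> y = x + y"
  "\<one>\<^bsub>free_ring\<^esub> = 1"
  "\<zero>\<^bsub>free_ring\<^esub> = 0"
  by (simp_all add: ring_of_type_algebra_def)

lemma ring_free_ring: "ring (free_ring :: ('g, 'f::field) free_algebra ring)"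
proof (intro ringI abelian_groupI monoidI)
  fix x :: "('g, 'f) free_algebra"
  show "\<exists>y\<in>carrier free_ring. y \<oplus>\<^bsub>free_ring\<^esub> x = \<zero>\<^bsub>free_ring\<^esub>"
    by (auto intro!: exI[of _ "- x"])
qed (simp_all add: algebra_simps)

text \<open>Negatives come from multiplication by \<open>- 1\<close>, so the subgroup condition
  reduces to zero and sums.\<close>

lemma ideal_free_ring_iff:
  fixes I :: "('g, 'f::field) free_algebra set"
  shows "ideal I free_ring \<longleftrightarrow>
    0 \<in> I \<and> (\<forall>p\<in>I. \<forall>r\<in>I. p + r \<in> I) \<and> (\<forall>p\<in>I. \<forall>r. r * p \<in> I \<and> p * r \<in> I)"
    (is "_ \<longleftrightarrow> ?R")
proof
  assume "ideal I free_ring"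
  then interpret ideal I free_ring .
  show ?R
    using additive_subgroup.zero_closed[OF is_additive_subgroup]
      additive_subgroup.a_closed[OF is_additive_subgroup] I_l_closed I_r_closed by simp
next
  interpret ring "free_ring :: ('g, 'f) free_algebra ring" by (rule ring_free_ring)
  assume R: ?R
  show "ideal I free_ring"
  proof (rule idealI[OF ring_free_ring])
    show "subgroup I (add_monoid free_ring)"
    proof (rule add.subgroupI)
      fix p assume "p \<in> I"
      then have "- p \<in> I" using R by (metis mult_minus1)
      moreover have "\<ominus>\<^bsub>free_ring\<^esub> p = - p"
        by (rule minus_equality) simp_all
      ultimately show "\<ominus>\<^bsub>free_ring\<^esub> p \<in> I" by simp
    qed (use R in auto)
  qed (use R in auto)
qed

section \<open>The ideal of relations and congruence modulo it\<close>

lemma ideal_Idl: "ideal (Idl\<^bsub>free_ring\<^esub> R) (free_ring :: ('g, 'f::field) free_algebra ring)"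
  by (rule ring.genideal_ideal[OF ring_free_ring]) simp

context
  fixes R :: "('g, 'f::field) free_algebra set"
begin

lemma Idl_zero: "0 \<in> Idl\<^bsub>free_ring\<^esub> R"
  and Idl_add: "p \<in> Idl\<^bsub>free_ring\<^esub> R \<Longrightarrow> r \<in> Idl\<^bsub>free_ring\<^esub> R \<Longrightarrow> p + r \<in> Idl\<^bsub>free_ring\<^esub> R"
  and Idl_mult_left: "p \<in> Idl\<^bsub>free_ring\<^esub> R \<Longrightarrow> r * p \<in> Idl\<^bsub>free_ring\<^esub> R"
  and Idl_mult_right: "p \<in> Idl\<^bsub>free_ring\<^esub> R \<Longrightarrow> p * r \<in> Idl\<^bsub>free_ring\<^esub> R"
  using ideal_Idl[of R] unfolding ideal_free_ring_iff by auto

lemma Idl_uminus: "p \<in> Idl\<^bsub>free_ring\<^esub> R \<Longrightarrow> - p \<in> Idl\<^bsub>free_ring\<^esub> R"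
  using Idl_mult_left[of p "- 1"] by simp

lemma Idl_base: "p \<in> R \<Longrightarrow> p \<in> Idl\<^bsub>free_ring\<^esub> R"
  using ring.genideal_self[OF ring_free_ring, of R] by auto

lemma presented_class_eq_iff:
  "presented_class R p = presented_class R r \<longleftrightarrow> p - r \<in> Idl\<^bsub>free_ring\<^esub> R"
proof -
  have cl: "presented_class R p = {h + p |h. h \<in> Idl\<^bsub>free_ring\<^esub> R}" for p
    by (auto simp: presented_class_def a_r_coset_def')
  show ?thesis
  proof
    assume "presented_class R p = presented_class R r"
    moreover have "p \<in> presented_class R p"
      using Idl_zero by (auto simp: cl intro: exI[of _ 0])
    ultimately show "p - r \<in> Idl\<^bsub>free_ring\<^esub> R" by (auto simp: cl)
  next
    have sub: "presented_class R p \<subseteq> presented_class R r" if "p - r \<in> Idl\<^bsub>free_ring\<^esub> R" for p r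
    proof
      fix x assume "x \<in> presented_class R p"
      then obtain h where "h \<in> Idl\<^bsub>free_ring\<^esub> R" "x = h + p" by (auto simp: cl)
      with that have "h + (p - r) \<in> Idl\<^bsub>free_ring\<^esub> R" "x = (h + (p - r)) + r"
        by (auto intro: Idl_add)
      then show "x \<in> presented_class R r" unfolding cl by blast
    qed
    assume "p - r \<in> Idl\<^bsub>free_ring\<^esub> R"
    then show "presented_class R p = presented_class R r"
      using sub[of p r] sub[of r p] Idl_uminus[of "p - r"] by auto
  qed
qed

section \<open>Operations on classes, and subalgebras\<close>

lemma carrier_presented_algebra: "carrier (presented_algebra R) = range (presented_class R)"
  by (auto simp: presented_algebra_def Let_def ring.defs module.defs FactRing_def A_RCOSETS_def'
      presented_class_def)

lemma presented_class_in_carrier [simp]: "presented_class R p \<in> carrier (presented_algebra R)"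
  by (simp add: carrier_presented_algebra)

lemma presented_algebra_mult [simp]:
  "presented_class R p \<otimes>\<^bsub>presented_algebra R\<^esub> presented_class R r = presented_class R (p * r)"
  using ideal.rcoset_mult_add[OF ideal_Idl, of p r R]
  by (simp add: presented_algebra_def Let_def ring.defs module.defs FactRing_def presented_class_def)

lemma presented_algebra_add [simp]:
  "presented_class R p \<oplus>\<^bsub>presented_algebra R\<^esub> presented_class R r = presented_class R (p + r)"
proof -
  interpret ideal "Idl\<^bsub>free_ring\<^esub> R" free_ring by (rule ideal_Idl)
  show ?thesis using a_rcos_sum[of p r]
    by (simp add: presented_algebra_def Let_def ring.defs module.defs FactRing_def presented_class_def)
qed

lemma presented_algebra_one: "\<one>\<^bsub>presented_algebra R\<^esub> = presented_class R 1"
  by (simp add: presented_algebra_def Let_def ring.defs module.defs FactRing_def presented_class_def)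

lemma presented_algebra_zero: "\<zero>\<^bsub>presented_algebra R\<^esub> = presented_class R 0"
proof -
  interpret ideal "Idl\<^bsub>free_ring\<^esub> R" free_ring by (rule ideal_Idl)
  show ?thesis
    by (simp add: presented_algebra_def Let_def ring.defs module.defs FactRing_def presented_class_def
      a_r_coset_def')
qed

lemma presented_algebra_smult [simp]:
  "c \<odot>\<^bsub>presented_algebra R\<^esub> presented_class R p = presented_class R (scalar c * p)"
proof -
  have "c \<odot>\<^bsub>presented_algebra R\<^esub> u = presented_class R (scalar c) \<otimes>\<^bsub>presented_algebra R\<^esub> u" for u
    by (simp add: presented_algebra_def Let_def ring.defs module.defs)
  then show ?thesis by simp
qed

lemma ring_presented_algebra: "ring (presented_algebra R)"
proof (intro ringI abelian_groupI monoidI)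
  fix x assume "x \<in> carrier (presented_algebra R)"
  then obtain p where "x = presented_class R p" by (auto simp: carrier_presented_algebra)
  then show "\<exists>y\<in>carrier (presented_algebra R).
      y \<oplus>\<^bsub>presented_algebra R\<^esub> x = \<zero>\<^bsub>presented_algebra R\<^esub>"
    by (intro bexI[of _ "presented_class R (- p)"]) (simp_all add: presented_algebra_zero)
qed (auto simp: carrier_presented_algebra presented_algebra_one presented_algebra_zero algebra_simps)

text \<open>Closure under negation is closure under the scalar \<open>- 1\<close>.\<close>

lemma is_subalgebra_presented_algebra_iff:
  "is_subalgebra H (presented_algebra R) \<longleftrightarrow>
    H \<subseteq> carrier (presented_algebra R) \<and> \<one>\<^bsub>presented_algebra R\<^esub> \<in> H \<and>
    (\<forall>u\<in>H. \<forall>v\<in>H. u \<otimes>\<^bsub>presented_algebra R\<^esub> v \<in> H) \<and>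
    (\<forall>u\<in>H. \<forall>v\<in>H. u \<oplus>\<^bsub>presented_algebra R\<^esub> v \<in> H) \<and>
    (\<forall>c. \<forall>u\<in>H. c \<odot>\<^bsub>presented_algebra R\<^esub> u \<in> H)"
    (is "_ \<longleftrightarrow> ?R")
proof
  interpret ring "presented_algebra R" by (rule ring_presented_algebra)
  show ?R if "is_subalgebra H (presented_algebra R)"
    using that subringE[of H] unfolding is_subalgebra_def by auto
  assume R: ?R
  have "\<ominus>\<^bsub>presented_algebra R\<^esub> u \<in> H" if "u \<in> H" for u
  proof -
    obtain p where p: "u = presented_class R p"
      using R \<open>u \<in> H\<close> unfolding carrier_presented_algebra by blast
    have "\<ominus>\<^bsub>presented_algebra R\<^esub> u = presented_class R (- p)"
      by (rule minus_equality) (simp_all add: p presented_algebra_zero)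
    also have "\<dots> = (- 1) \<odot>\<^bsub>presented_algebra R\<^esub> u"
      by (simp add: p scalar_uminus)
    finally show ?thesis using R that by simp
  qed
  then have "subring H (presented_algebra R)"
    using R by (intro subringI) simp_all
  with R show "is_subalgebra H (presented_algebra R)"
    unfolding is_subalgebra_def by blast
qed

text \<open>The carrier is a subalgebra containing \<open>S\<close>, so the intersection runs over a
  nonempty family and stays inside the carrier.\<close>

lemma is_subalgebra_generated:
  assumes "S \<subseteq> carrier (presented_algebra R)"
  shows "is_subalgebra (generated_subalgebra (presented_algebra R) S) (presented_algebra R)"
proof -
  have "is_subalgebra (carrier (presented_algebra R)) (presented_algebra R)"
    unfolding is_subalgebra_presented_algebra_iff
    by (auto simp: carrier_presented_algebra presented_algebra_one)
  with assms have "\<exists>H. is_subalgebra H (presented_algebra R) \<and> S \<subseteq> H"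
    by blast
  then show ?thesis
    unfolding is_subalgebra_presented_algebra_iff generated_subalgebra_def
    by (intro conjI ballI allI subsetI InterI) (auto dest: subsetD)
qed

lemma generated_subalgebra_subset:
  "is_subalgebra H A \<Longrightarrow> S \<subseteq> H \<Longrightarrow> generated_subalgebra A S \<subseteq> H"
  unfolding generated_subalgebra_def by blast

lemma generated_subalgebra_base: "S \<subseteq> generated_subalgebra A S"
  unfolding generated_subalgebra_def by blast

end

section \<open>Maps on presented algebras\<close>

lemma presented_algebraE:
  assumes "u \<in> carrier (presented_algebra R)"
  obtains p where "u = presented_class R p"
  using assms by (auto simp: carrier_presented_algebra)

text \<open>The premise \<open>mult\<close> only asks that agreement passes to products. It holds
  for two automorphisms and for two antiautomorphisms, so both uniqueness statements follow from
  this one induction.\<close>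

lemma linear_bijection_eqI:
  fixes R :: "('g, 'f::field) free_algebra set"
  defines "A \<equiv> presented_algebra R"
  assumes g: "linear_bijection A g" and h: "linear_bijection A h"
    and one: "g \<one>\<^bsub>A\<^esub> = h \<one>\<^bsub>A\<^esub>"
    and gen: "\<And>l. g (presented_class R (letter l)) = h (presented_class R (letter l))"
    and mult: "\<And>u v. \<lbrakk>u \<in> carrier A; v \<in> carrier A; g u = h u; g v = h v\<rbrakk>
      \<Longrightarrow> g (u \<otimes>\<^bsub>A\<^esub> v) = h (u \<otimes>\<^bsub>A\<^esub> v)"
  shows "g = h"
proof (rule extensionalityI)
  show "g \<in> extensional (carrier A)" "h \<in> extensional (carrier A)"
    using g h by (auto simp: linear_bijection_def)
  have "g (presented_class R p) = h (presented_class R p)" for p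
  proof (induction p rule: free_algebra_induct)
    case (scalar c)
    have eq: "presented_class R (scalar c) = c \<odot>\<^bsub>A\<^esub> \<one>\<^bsub>A\<^esub>" "\<one>\<^bsub>A\<^esub> \<in> carrier A"
      by (simp_all add: A_def presented_algebra_one)
    show ?case using g h one unfolding eq linear_bijection_def by (simp add: eq(2))
  next
    case (letter l)
    show ?case by (rule gen)
  next
    case (add p r)
    have eq: "presented_class R (p + r) = presented_class R p \<oplus>\<^bsub>A\<^esub> presented_class R r"
      by (simp add: A_def)
    have car: "presented_class R p \<in> carrier A" "presented_class R r \<in> carrier A"
      by (simp_all add: A_def)
    show ?case using g h add car unfolding eq linear_bijection_def by simp
  next
    case (mult p r)
    then show ?case using assms(6)[of "presented_class R p" "presented_class R r"]
      by (simp add: A_def)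
  qed
  then show "g u = h u" if "u \<in> carrier A" for u
    using that by (auto simp: A_def elim: presented_algebraE)
qed

text \<open>By surjectivity some \<open>u\<close> is sent to the unit; applying \<open>g\<close> to
  \<open>u\<close> times the unit then gives \<open>g u = g 1\<close>.\<close>

lemma algebra_antiautomorphism_one:
  assumes "algebra_antiautomorphism (presented_algebra R) g"
  shows "g \<one>\<^bsub>presented_algebra R\<^esub> = \<one>\<^bsub>presented_algebra R\<^esub>"
proof -
  interpret ring "presented_algebra R" by (rule ring_presented_algebra)
  have bij: "bij_betw g (carrier (presented_algebra R)) (carrier (presented_algebra R))"
    using assms unfolding algebra_antiautomorphism_def linear_bijection_def by blast
  then have "\<one>\<^bsub>presented_algebra R\<^esub> \<in> g ` carrier (presented_algebra R)"
    by (simp add: bij_betw_imp_surj_on)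
  then obtain u where u: "u \<in> carrier (presented_algebra R)" "g u = \<one>\<^bsub>presented_algebra R\<^esub>"
    by (metis imageE)
  have "g (u \<otimes>\<^bsub>presented_algebra R\<^esub> \<one>\<^bsub>presented_algebra R\<^esub>)
      = g \<one>\<^bsub>presented_algebra R\<^esub> \<otimes>\<^bsub>presented_algebra R\<^esub> g u"
    using assms u(1) one_closed unfolding algebra_antiautomorphism_def by blast
  moreover have "g \<one>\<^bsub>presented_algebra R\<^esub> \<in> carrier (presented_algebra R)"
    using bij bij_betwE by blast
  ultimately show ?thesis using u by simp
qed

lemma algebra_automorphism_eqI:
  assumes "algebra_automorphism (presented_algebra R) g" "algebra_automorphism (presented_algebra R) h"
    and "\<And>l. g (presented_class R (letter l)) = h (presented_class R (letter l))"
  shows "g = h"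
  using assms by (intro linear_bijection_eqI[of R g h]) (simp_all add: algebra_automorphism_def)

lemma algebra_antiautomorphism_eqI:
  assumes "algebra_antiautomorphism (presented_algebra R) g"
    and "algebra_antiautomorphism (presented_algebra R) h"
    and "\<And>l. g (presented_class R (letter l)) = h (presented_class R (letter l))"
  shows "g = h"
  using assms algebra_antiautomorphism_one[OF assms(1)] algebra_antiautomorphism_one[OF assms(2)]
  by (intro linear_bijection_eqI[of R g h]) (simp_all add: algebra_antiautomorphism_def)

text \<open>Minimality of the generated subalgebra is used twice. Its preimage is a subalgebra
  containing \<open>S\<close> by \<open>sub\<close>; its image is a subalgebra containing
  \<open>S\<close> by \<open>sup\<close>.\<close>

lemma image_generated_subalgebra:
  fixes R :: "('g, 'f::field) free_algebra set"
  defines "A \<equiv> presented_algebra R"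
  assumes g: "algebra_automorphism A g \<or> algebra_antiautomorphism A g"
    and S: "S \<subseteq> carrier A"
    and sub: "g ` S \<subseteq> generated_subalgebra A S"
    and sup: "S \<subseteq> g ` generated_subalgebra A S"
  shows "g ` generated_subalgebra A S = generated_subalgebra A S"
proof
  interpret ring A unfolding A_def by (rule ring_presented_algebra)
  let ?G = "generated_subalgebra A S"
  have lin: "linear_bijection A g"
    using g by (auto simp: algebra_automorphism_def algebra_antiautomorphism_def)
  then have g_car: "g u \<in> carrier A" if "u \<in> carrier A" for u
    using that bij_betwE unfolding linear_bijection_def by blast
  have g_add: "g (u \<oplus>\<^bsub>A\<^esub> v) = g u \<oplus>\<^bsub>A\<^esub> g v" if "u \<in> carrier A" "v \<in> carrier A" for u v
    using lin that unfolding linear_bijection_def by blast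
  have g_smult: "g (c \<odot>\<^bsub>A\<^esub> u) = c \<odot>\<^bsub>A\<^esub> g u" if "u \<in> carrier A" for c u
    using lin that unfolding linear_bijection_def by blast
  have smult_car: "c \<odot>\<^bsub>A\<^esub> u \<in> carrier A" if "u \<in> carrier A" for c u
    using that unfolding A_def by (auto elim!: presented_algebraE)
  have g_one: "g \<one>\<^bsub>A\<^esub> = \<one>\<^bsub>A\<^esub>"
    using g algebra_antiautomorphism_one unfolding A_def algebra_automorphism_def by blast
  \<comment> \<open>The two-element sets treat both kinds of map at once: a subalgebra contains the
    products in either order.\<close>
  have g_mult: "g (u \<otimes>\<^bsub>A\<^esub> v) \<in> {g u \<otimes>\<^bsub>A\<^esub> g v, g v \<otimes>\<^bsub>A\<^esub> g u}"
    if "u \<in> carrier A" "v \<in> carrier A" for u v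
    using g that unfolding algebra_automorphism_def algebra_antiautomorphism_def by blast
  have g_mult': "g u \<otimes>\<^bsub>A\<^esub> g v \<in> {g (u \<otimes>\<^bsub>A\<^esub> v), g (v \<otimes>\<^bsub>A\<^esub> u)}"
    if "u \<in> carrier A" "v \<in> carrier A" for u v
    using g that unfolding algebra_automorphism_def algebra_antiautomorphism_def by auto
  note sa_iff = is_subalgebra_presented_algebra_iff[of _ R, folded A_def]
  have G: "is_subalgebra ?G A"
    using S unfolding A_def by (rule is_subalgebra_generated)
  then have G_car: "?G \<subseteq> carrier A" by (simp add: sa_iff)
  have "is_subalgebra {u \<in> carrier A. g u \<in> ?G} A"
    unfolding sa_iff
  proof (intro conjI ballI allI)
    fix u v assume "u \<in> {u \<in> carrier A. g u \<in> ?G}" "v \<in> {u \<in> carrier A. g u \<in> ?G}"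
    then have uv: "u \<in> carrier A" "v \<in> carrier A" "g u \<in> ?G" "g v \<in> ?G" by auto
    with G have "{g u \<otimes>\<^bsub>A\<^esub> g v, g v \<otimes>\<^bsub>A\<^esub> g u} \<subseteq> ?G" "g u \<oplus>\<^bsub>A\<^esub> g v \<in> ?G"
      by (simp_all add: sa_iff)
    with uv g_mult[of u v] show "u \<otimes>\<^bsub>A\<^esub> v \<in> {u \<in> carrier A. g u \<in> ?G}"
      "u \<oplus>\<^bsub>A\<^esub> v \<in> {u \<in> carrier A. g u \<in> ?G}"
      by (auto simp: g_add)
  qed (use G in \<open>auto simp: sa_iff g_one g_smult smult_car\<close>)
  then have "?G \<subseteq> {u \<in> carrier A. g u \<in> ?G}"
    by (rule generated_subalgebra_subset) (use S sub in auto)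
  then show "g ` ?G \<subseteq> ?G" by blast
  have "is_subalgebra (g ` ?G) A"
    unfolding sa_iff
  proof (intro conjI ballI allI)
    show "g ` ?G \<subseteq> carrier A" using g_car G_car by blast
    show "\<one>\<^bsub>A\<^esub> \<in> g ` ?G"
      using G by (auto simp: sa_iff g_one intro!: image_eqI[of _ _ "\<one>\<^bsub>A\<^esub>"])
  next
    fix s t assume "s \<in> g ` ?G" "t \<in> g ` ?G"
    then obtain u v where uv: "s = g u" "t = g v" "u \<in> ?G" "v \<in> ?G" by blast
    with G_car have "u \<in> carrier A" "v \<in> carrier A" by auto
    moreover have "u \<otimes>\<^bsub>A\<^esub> v \<in> ?G" "v \<otimes>\<^bsub>A\<^esub> u \<in> ?G" "u \<oplus>\<^bsub>A\<^esub> v \<in> ?G"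
      using G uv by (auto simp: sa_iff)
    ultimately show "s \<otimes>\<^bsub>A\<^esub> t \<in> g ` ?G" "s \<oplus>\<^bsub>A\<^esub> t \<in> g ` ?G"
      using g_mult'[of u v] uv by (auto simp flip: g_add)
  next
    fix c s assume "s \<in> g ` ?G"
    then obtain u where u: "s = g u" "u \<in> ?G" by blast
    then have "c \<odot>\<^bsub>A\<^esub> u \<in> ?G" "u \<in> carrier A" using G G_car by (auto simp: sa_iff)
    then show "c \<odot>\<^bsub>A\<^esub> s \<in> g ` ?G" using u by (auto simp flip: g_smult)
  qed
  then show "?G \<subseteq> g ` ?G" using sup by (rule generated_subalgebra_subset)
qed

text \<open>The chosen representative is immaterial once \<open>F\<close> preserves the ideal.
  Restriction to the carrier matches the normalisation in \<open>linear_bijection\<close>.\<close>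

definition induced_map ::
    "('g, 'f::field) free_algebra set \<Rightarrow> (('g, 'f) free_algebra \<Rightarrow> ('g, 'f) free_algebra)
      \<Rightarrow> ('g, 'f) free_algebra set \<Rightarrow> ('g, 'f) free_algebra set" where
  "induced_map R F = (\<lambda>u\<in>carrier (presented_algebra R).
     presented_class R (F (SOME p. presented_class R p = u)))"

text \<open>The disjunction in \<open>map_mult\<close> lets homomorphisms and antihomomorphisms
  share the descent to the quotient. For substitutions, \<open>map_relation\<close> is the condition
  with real content.\<close>

locale descending_map =
  fixes R :: "('g, 'f::field) free_algebra set"
    and F :: "('g, 'f) free_algebra \<Rightarrow> ('g, 'f) free_algebra"
  assumes map_add: "F (p + r) = F p + F r"
    and map_mult: "(\<forall>p r. F (p * r) = F p * F r) \<or> (\<forall>p r. F (p * r) = F r * F p)"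
    and map_scalar: "F (scalar c) = scalar c"
    and map_relation: "p \<in> R \<Longrightarrow> F p \<in> Idl\<^bsub>free_ring\<^esub> R"
begin

lemma map_zero: "F 0 = 0"
  using map_scalar[of 0] by simp

lemma map_minus: "F (p - r) = F p - F r"
  using map_add[of "p - r" r] by simp

lemma map_scalar_mult: "F (scalar c * p) = scalar c * F p"
  using map_mult by (auto simp: map_scalar scalar_commute)

text \<open>The preimage of the ideal under \<open>F\<close> is again an ideal containing
  \<open>R\<close>. For antimultiplicative \<open>F\<close> the two sides swap, which is harmless as
  the ideal is two-sided.\<close>

lemma map_Idl:
  assumes "p \<in> Idl\<^bsub>free_ring\<^esub> R"
  shows "F p \<in> Idl\<^bsub>free_ring\<^esub> R"
proof -
  have "ideal {p. F p \<in> Idl\<^bsub>free_ring\<^esub> R} free_ring"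
    using map_mult unfolding ideal_free_ring_iff
    by (auto simp: map_zero map_add Idl_zero Idl_add Idl_mult_left Idl_mult_right)
  then have "Idl\<^bsub>free_ring\<^esub> R \<subseteq> {p. F p \<in> Idl\<^bsub>free_ring\<^esub> R}"
    by (rule ring.genideal_minimal[OF ring_free_ring]) (auto simp: map_relation)
  with assms show ?thesis by blast
qed

lemma induced_map_class [simp]:
  "induced_map R F (presented_class R p) = presented_class R (F p)"
proof -
  define r where "r = (SOME r. presented_class R r = presented_class R p)"
  have "presented_class R r = presented_class R p"
    unfolding r_def by (rule someI) simp
  then have "F (r - p) \<in> Idl\<^bsub>free_ring\<^esub> R"
    by (intro map_Idl) (simp add: presented_class_eq_iff)
  then have "presented_class R (F r) = presented_class R (F p)"
    by (simp add: presented_class_eq_iff map_minus)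
  moreover have "induced_map R F (presented_class R p) = presented_class R (F r)"
    by (simp add: induced_map_def r_def)
  ultimately show ?thesis by simp
qed

text \<open>The map induced by \<open>G\<close> is the inverse on classes.\<close>

lemma linear_bijection_induced_map:
  assumes "descending_map R G" "\<And>p. F (G p) = p" "\<And>p. G (F p) = p"
  shows "linear_bijection (presented_algebra R) (induced_map R F)"
proof -
  interpret G: descending_map R G by fact
  have "bij_betw (induced_map R F) (carrier (presented_algebra R)) (carrier (presented_algebra R))"
    by (rule bij_betw_byWitness[of _ "induced_map R G"])
      (auto simp: carrier_presented_algebra assms)
  moreover have "induced_map R F \<in> extensional (carrier (presented_algebra R))"
    unfolding induced_map_def by (rule restrict_extensional)
  ultimately show ?thesis
    by (auto simp: linear_bijection_def map_add map_scalar_mult elim!: presented_algebraE)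
qed

end

lemma algebra_automorphism_induced_map:
  assumes "descending_map R F" "descending_map R G" "\<And>p. F (G p) = p" "\<And>p. G (F p) = p"
    and "\<And>p r. F (p * r) = F p * F r"
  shows "algebra_automorphism (presented_algebra R) (induced_map R F)"
proof -
  interpret descending_map R F by fact
  show ?thesis
    using linear_bijection_induced_map[OF assms(2-4)] map_scalar[of 1]
    by (auto simp: algebra_automorphism_def presented_algebra_one assms(5) elim!: presented_algebraE)
qed

lemma algebra_antiautomorphism_induced_map:
  assumes "descending_map R F" "descending_map R G" "\<And>p. F (G p) = p" "\<And>p. G (F p) = p"
    and "\<And>p r. F (p * r) = F r * F p"
  shows "algebra_antiautomorphism (presented_algebra R) (induced_map R F)"
proof -
  interpret descending_map R F by fact
  show ?thesis
    using linear_bijection_induced_map[OF assms(2-4)]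
    by (auto simp: algebra_antiautomorphism_def assms(5) elim!: presented_algebraE)
qed

section \<open>The relations of \<open>U\<^sub>q(sl\<^sub>2)\<close>\<close>

text \<open>
  With \<open>scalar c\<close> hidden in \<open>scale\<close>, scalars can be moved to the front by terminating rewrite rules;
  \<open>scalar_left_commute\<close> would swap two scalars forever.
\<close>

definition scale :: "'f::field \<Rightarrow> ('g, 'f) free_algebra \<Rightarrow> ('g, 'f) free_algebra" where
  "scale c p = scalar c * p"

lemma scale_simps:
  "scale c p * r = scale c (p * r)"
  "p * scale c r = scale c (p * r)"
  "scale c (scale d p) = scale (c * d) p"
  "scale c (p + r) = scale c p + scale c r"
  "scale c (p - r) = scale c p - scale c r"
  "scale c (- p) = - scale c p"
  "scale 1 p = p"
  by (simp_all only: scale_def scalar_left_commute[of p c r] scalar_mult_left distrib_left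
      right_diff_distrib mult.assoc scalar_1 mult_1_left mult_minus_right)

lemma scale_diff_left: "scale (c - d) p = scale c p - scale d p"
  by (simp add: scale_def scalar_diff left_diff_distrib)

text \<open>The coefficient of \<open>v\<close> is
  \<open>c * (1 - d) + (1 - c) = 1 - c * d = 0\<close>. This makes the substitutions for
  \<open>c\<close> and \<open>inverse c\<close> mutually inverse.\<close>

lemma scale_affine_cancel:
  assumes "c * d = 1"
  shows "scale c (scale d u + scale (1 - d) v) + scale (1 - c) v = u"
  by (simp add: scale_simps assms scale_diff_left right_diff_distrib)

text \<open>Unlike \<open>q_weyl\<close>, it takes arbitrary elements, as needed to describe the
  images of the relations under substitution.\<close>

definition weyl ::
    "'f::field \<Rightarrow> ('g, 'f) free_algebra \<Rightarrow> ('g, 'f) free_algebra \<Rightarrow> ('g, 'f) free_algebra"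
  where "weyl q u v = scale (inverse (q - inverse q)) (scale q (u * v) - scale (inverse q) (v * u))"

lemma q_weyl_eq: "q_weyl q g h = weyl q (letter g) (letter h)"
  by (simp add: q_weyl_def weyl_def scale_def mult.assoc)

lemma weyl_linear_left:
  "weyl q (scale b u + scale b' u') v = scale b (weyl q u v) + scale b' (weyl q u' v)"
  by (simp add: weyl_def scale_simps algebra_simps)

lemma weyl_linear_right:
  "weyl q u (scale b v + scale b' v') = scale b (weyl q u v) + scale b' (weyl q u v')"
  by (simp add: weyl_def scale_simps algebra_simps)

context
  fixes q :: "'f::field"
  assumes q: "q - inverse q \<noteq> 0"
begin

lemma weyl_self: "weyl q u u = u * u"
  using q by (simp add: weyl_def scale_simps(3,7) flip: scale_diff_left)

text \<open>Shows that \<open>weyl q u v\<close> is 1 modulo any ideal in which \<open>u\<close> and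
  \<open>v\<close> become mutually inverse.\<close>

lemma weyl_inverse_pair:
  "weyl q u v - 1 = scale (inverse (q - inverse q)) (scale q (u * v - 1) - scale (inverse q) (v * u - 1))"
proof -
  have one: "1 = scale (inverse (q - inverse q)) (scale q 1 - scale (inverse q) (1 :: ('a, 'f) free_algebra))"
    using q by (simp add: scale_simps(3,7) flip: scale_diff_left)
  show ?thesis by (subst one) (simp add: weyl_def scale_simps)
qed

end

text \<open>Here \<open>w\<close> stands for \<open>y\<inverse>\<close>, and the last summand vanishes modulo \<open>y w = w y = 1\<close>.\<close>

lemma weyl_conj_left:
  "weyl q z w - w * w = w * (weyl q y z - 1) * w
    + scale (inverse (q - inverse q))
       (scale (inverse q) (w * z * (y * w - 1)) - scale q ((w * y - 1) * z * w))"
  by (simp add: weyl_def scale_simps algebra_simps)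

lemma weyl_conj_right:
  "weyl q w x - w * w = w * (weyl q x y - 1) * w
    + scale (inverse (q - inverse q))
       (scale (inverse q) ((w * y - 1) * x * w) - scale q (w * x * (y * w - 1)))"
  by (simp add: weyl_def scale_simps algebra_simps)

lemma free_hom_scale [simp]: "free_hom s (scale c p) = scale c (free_hom s p)"
  by (simp add: scale_def free_hom_mult)

lemma free_antihom_scale [simp]: "free_antihom s (scale c p) = scale c (free_antihom s p)"
  by (simp add: scale_def free_antihom_mult scalar_commute)

lemma free_hom_diff: "free_hom s (p - r) = free_hom s p - free_hom s r"
  using free_hom_add[of s "p - r" r] by simp

lemma free_antihom_diff: "free_antihom s (p - r) = free_antihom s p - free_antihom s r"
  using free_antihom_add[of s "p - r" r] by simp

lemma free_hom_weyl: "free_hom s (weyl q u v) = weyl q (free_hom s u) (free_hom s v)"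
  by (simp add: weyl_def free_hom_diff free_hom_mult)

lemma free_antihom_weyl: "free_antihom s (weyl q u v) = weyl q (free_antihom s v) (free_antihom s u)"
  by (simp add: weyl_def free_antihom_diff free_antihom_mult)

lemma free_hom_one [simp]: "free_hom s 1 = 1"
  using free_hom_scalar[of s 1] by simp

lemma free_antihom_one [simp]: "free_antihom s 1 = 1"
  using free_antihom_scalar[of s 1] by simp

lemma Idl_scale: "p \<in> Idl\<^bsub>free_ring\<^esub> R \<Longrightarrow> scale c p \<in> Idl\<^bsub>free_ring\<^esub> R"
  by (simp add: scale_def Idl_mult_left)

lemma Idl_diff: "p \<in> Idl\<^bsub>free_ring\<^esub> R \<Longrightarrow> r \<in> Idl\<^bsub>free_ring\<^esub> R \<Longrightarrow> p - r \<in> Idl\<^bsub>free_ring\<^esub> R"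
  using Idl_add[of p R "- r"] by (simp add: Idl_uminus)

section \<open>Lifts of \<tau> and \<sigma> to the free algebra\<close>

lemma Uq_relations_eq: "Uq_relations q =
  {letter Gy * letter Gyinv - 1, letter Gyinv * letter Gy - 1, weyl q (letter Gx) (letter Gy) - 1,
   weyl q (letter Gy) (letter Gz) - 1, weyl q (letter Gz) (letter Gx) - 1}"
  by (simp add: Uq_relations_def q_weyl_eq)

fun tau_letter :: "gen \<Rightarrow> (gen, 'f::field) free_algebra" where
  "tau_letter Gx = letter Gz"
| "tau_letter Gy = letter Gy"
| "tau_letter Gyinv = letter Gyinv"
| "tau_letter Gz = letter Gx"

lemma tau_free_involution: "free_antihom tau_letter (free_antihom tau_letter p) = p"
proof (induction p rule: free_algebra_induct)
  case (letter l)
  then show ?case by (cases l) simp_all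
qed (simp_all add: free_antihom_add free_antihom_mult)

lemma descending_tau: "descending_map (Uq_relations q) (free_antihom tau_letter)"
proof
  fix p assume "p \<in> Uq_relations q"
  \<comment> \<open>The relations for \<open>x, y\<close> and \<open>y, z\<close> are exchanged, as
    are the two for the inverse of \<open>y\<close>; the one for \<open>z, x\<close> is
    fixed.\<close>
  then have "free_antihom tau_letter p \<in> Uq_relations q"
    by (auto simp: Uq_relations_eq free_antihom_diff free_antihom_mult free_antihom_weyl)
  then show "free_antihom tau_letter p \<in> Idl\<^bsub>free_ring\<^esub> (Uq_relations q)"
    by (rule Idl_base)
qed (simp_all add: free_antihom_add free_antihom_mult)

text \<open>The parameter \<open>c\<close> plays the role of \<open>a^2\<close>; the inverse
  substitution has parameter \<open>inverse c\<close>.\<close>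

fun sigma_letter :: "'f \<Rightarrow> gen \<Rightarrow> (gen, 'f::field) free_algebra" where
  "sigma_letter c Gx = scale (inverse c) (letter Gx) + scale (1 - inverse c) (letter Gyinv)"
| "sigma_letter c Gy = letter Gy"
| "sigma_letter c Gyinv = letter Gyinv"
| "sigma_letter c Gz = scale c (letter Gz) + scale (1 - c) (letter Gyinv)"

lemma sigma_free_inverse:
  assumes "c \<noteq> 0"
  shows "free_hom (sigma_letter c) (free_hom (sigma_letter (inverse c)) p) = p"
proof (induction p rule: free_algebra_induct)
  case (letter l)
  show ?case using assms
    by (cases l) (simp_all add: free_hom_add scale_affine_cancel)
qed (simp_all add: free_hom_add free_hom_mult)

lemma descending_sigma:
  fixes q :: "'f::field"
  assumes q: "q - inverse q \<noteq> 0" and c: "c \<noteq> 0"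
  shows "descending_map (Uq_relations q) (free_hom (sigma_letter c))"
proof
  let ?I = "Idl\<^bsub>free_ring\<^esub> (Uq_relations q)"
  define x y w z :: "(gen, 'f) free_algebra"
    where "x = letter Gx" and "y = letter Gy" and "w = letter Gyinv" and "z = letter Gz"
  note xyz = x_def y_def w_def z_def
  have rel: "y * w - 1 \<in> ?I" "w * y - 1 \<in> ?I"
    "weyl q x y - 1 \<in> ?I" "weyl q y z - 1 \<in> ?I" "weyl q z x - 1 \<in> ?I"
    by (auto intro!: Idl_base simp: Uq_relations_eq xyz)
  note Idl_rules = Idl_add Idl_diff Idl_scale Idl_mult_left Idl_mult_right
  have wy: "weyl q w y - 1 \<in> ?I" and yw: "weyl q y w - 1 \<in> ?I"
    unfolding weyl_inverse_pair[OF q] by (intro Idl_rules rel)+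
  \<comment> \<open>The instance at \<open>rel(1)\<close> takes the product ending in
    \<open>y * w - 1\<close>, where \<open>Idl_mult_right\<close> would drop the factor lying in the
    ideal.\<close>
  have zw: "weyl q z w - w * w \<in> ?I"
    unfolding weyl_conj_left[where y = y] by (intro Idl_add Idl_diff Idl_scale
        Idl_mult_left[OF rel(1)] Idl_mult_right Idl_mult_left rel)
  have wx: "weyl q w x - w * w \<in> ?I"
    unfolding weyl_conj_right[where y = y] by (intro Idl_add Idl_diff Idl_scale
        Idl_mult_left[OF rel(1)] Idl_mult_right Idl_mult_left rel)
  let ?b = "inverse c"
  let ?X = "scale ?b x + scale (1 - ?b) w" and ?Z = "scale c z + scale (1 - c) w"
  \<comment> \<open>The coefficients \<open>?b\<close> and \<open>1 - ?b\<close> sum to 1, so the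
    constant 1 can be split between the two terms.\<close>
  have "weyl q ?X y - 1 = scale ?b (weyl q x y - 1) + scale (1 - ?b) (weyl q w y - 1)"
    unfolding weyl_linear_left by (simp add: scale_simps scale_diff_left)
  also have "\<dots> \<in> ?I" by (intro Idl_rules rel wy)
  finally have Xy: "weyl q ?X y - 1 \<in> ?I" .
  have "weyl q y ?Z - 1 = scale c (weyl q y z - 1) + scale (1 - c) (weyl q y w - 1)"
    unfolding weyl_linear_right by (simp add: scale_simps scale_diff_left)
  also have "\<dots> \<in> ?I" by (intro Idl_rules rel yw)
  finally have yZ: "weyl q y ?Z - 1 \<in> ?I" .
  \<comment> \<open>Here \<open>c * ?b = 1\<close>. The term \<open>weyl q w w\<close> equals
    \<open>w * w\<close>, and the total coefficient
    \<open>c * (1 - ?b) + (1 - c) * ?b + (1 - c) * (1 - ?b)\<close> of \<open>w * w\<close> is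
    0.\<close>
  have "weyl q ?Z ?X - 1 = (weyl q z x - 1) + scale (c * (1 - ?b)) (weyl q z w - w * w)
      + scale ((1 - c) * ?b) (weyl q w x - w * w)"
    unfolding weyl_linear_right weyl_linear_left weyl_self[OF q]
    using c by (simp add: scale_simps scale_diff_left algebra_simps)
  also have "\<dots> \<in> ?I" by (intro Idl_rules rel zw wx)
  finally have ZX: "weyl q ?Z ?X - 1 \<in> ?I" .
  show "free_hom (sigma_letter c) p \<in> ?I" if "p \<in> Uq_relations q" for p
    using that rel Xy yZ ZX
    by (auto simp: Uq_relations_eq free_hom_diff free_hom_mult free_hom_weyl xyz)
qed (simp_all add: free_hom_add free_hom_mult)

section \<open>The maps \<open>\<tau>\<close> and \<open>\<sigma>\<close>\<close>

text \<open>Justifies the description operator in \<open>tau_def\<close>: the induced map is a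
  witness, and its values on the letters determine it.\<close>

lemma tau_characterization:
  "algebra_antiautomorphism (Uq q) (tau q) \<and>
   tau q (Uq_gen q Gx) = Uq_gen q Gz \<and>
   tau q (Uq_gen q Gy) = Uq_gen q Gy \<and>
   tau q (Uq_gen q Gyinv) = Uq_gen q Gyinv \<and>
   tau q (Uq_gen q Gz) = Uq_gen q Gx"
    (is "?P (tau q)")
  unfolding tau_def
proof (rule theI[of ?P])
  interpret descending_map "Uq_relations q" "free_antihom tau_letter"
    by (rule descending_tau)
  let ?t = "induced_map (Uq_relations q) (free_antihom tau_letter)"
  show ex: "?P ?t"
    using algebra_antiautomorphism_induced_map[OF descending_tau descending_tau
        tau_free_involution tau_free_involution free_antihom_mult]
    by (simp add: Uq_def Uq_gen_def)
  show "g = ?t" if "?P g" for g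
  proof (rule algebra_antiautomorphism_eqI)
    show "g (presented_class (Uq_relations q) (letter l)) = ?t (presented_class (Uq_relations q) (letter l))"
      for l
      using that ex unfolding Uq_gen_def by (cases l) metis+
  qed (use that ex in \<open>simp_all add: Uq_def\<close>)
qed

lemma sigma_characterization:
  fixes q a :: "'f::field"
  assumes q: "q - inverse q \<noteq> 0" and a: "a \<noteq> 0"
  shows "algebra_automorphism (Uq q) (sigma q a) \<and>
     sigma q a (Uq_gen q Gx) =
       (inverse (a^2) \<odot>\<^bsub>Uq q\<^esub> Uq_gen q Gx) \<oplus>\<^bsub>Uq q\<^esub> ((1 - inverse (a^2)) \<odot>\<^bsub>Uq q\<^esub> Uq_gen q Gyinv) \<and>
     sigma q a (Uq_gen q Gy) = Uq_gen q Gy \<and>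
     sigma q a (Uq_gen q Gyinv) = Uq_gen q Gyinv \<and>
     sigma q a (Uq_gen q Gz) =
       (a^2 \<odot>\<^bsub>Uq q\<^esub> Uq_gen q Gz) \<oplus>\<^bsub>Uq q\<^esub> ((1 - a^2) \<odot>\<^bsub>Uq q\<^esub> Uq_gen q Gyinv)"
    (is "?P (sigma q a)")
  unfolding sigma_def
proof (rule theI[of ?P])
  define c where "c = a\<^sup>2"
  have c: "c \<noteq> 0" "inverse c \<noteq> 0" using a by (simp_all add: c_def)
  interpret descending_map "Uq_relations q" "free_hom (sigma_letter c)"
    by (rule descending_sigma[OF q c(1)])
  let ?s = "induced_map (Uq_relations q) (free_hom (sigma_letter c))"
  have "algebra_automorphism (Uq q) ?s"
    unfolding Uq_def
    \<comment> \<open>The second instance gives the other composite, as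
      \<open>inverse (inverse c) = c\<close>.\<close>
    using sigma_free_inverse[OF c(1)] sigma_free_inverse[OF c(2)]
    by (intro algebra_automorphism_induced_map[OF descending_sigma[OF q c(1)]
          descending_sigma[OF q c(2)]] free_hom_mult) simp_all
  then show ex: "?P ?s"
    by (simp add: Uq_def Uq_gen_def scale_def flip: c_def)
  show "g = ?s" if "?P g" for g
  proof (rule algebra_automorphism_eqI)
    show "g (presented_class (Uq_relations q) (letter l)) = ?s (presented_class (Uq_relations q) (letter l))"
      for l
      using that ex unfolding Uq_gen_def by (cases l) metis+
  qed (use that ex in \<open>simp_all add: Uq_def\<close>)
qed

section \<open>Images of the subalgebra\<close>

lemma tau_image: "tau q ` Uq_vee q = Uq_vee q"
proof -
  let ?S = "{Uq_gen q Gx, Uq_gen q Gyinv, Uq_gen q Gz}"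
  note t = tau_characterization[of q]
  have S: "?S \<subseteq> Uq_vee q"
    unfolding Uq_vee_def by (rule generated_subalgebra_base)
  \<comment> \<open>The three generators are permuted, which settles images and preimages
    together.\<close>
  have "tau q ` ?S = ?S" using t by auto
  then show ?thesis
    using t S image_mono[OF S, of "tau q"] unfolding Uq_vee_def Uq_def
    by (intro image_generated_subalgebra) (auto simp: Uq_gen_def)
qed

lemma sigma_image:
  fixes q a :: "'f::field"
  assumes q: "q - inverse q \<noteq> 0" and a: "a \<noteq> 0"
  shows "sigma q a ` Uq_vee q = Uq_vee q"
proof -
  let ?S = "{Uq_gen q Gx, Uq_gen q Gyinv, Uq_gen q Gz}"
  note s = sigma_characterization[OF q a]
  define c where "c = a\<^sup>2"
  have c: "c \<noteq> 0" using a by (simp add: c_def)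
  let ?comb = "\<lambda>d l. (d \<odot>\<^bsub>Uq q\<^esub> Uq_gen q l) \<oplus>\<^bsub>Uq q\<^esub> ((1 - d) \<odot>\<^bsub>Uq q\<^esub> Uq_gen q Gyinv)"
  have S: "?S \<subseteq> Uq_vee q"
    unfolding Uq_vee_def by (rule generated_subalgebra_base)
  have S_car: "?S \<subseteq> carrier (Uq q)" by (simp add: Uq_gen_def Uq_def)
  have "is_subalgebra (Uq_vee q) (Uq q)"
    using S_car unfolding Uq_vee_def Uq_def by (rule is_subalgebra_generated)
  then have comb: "?comb d l \<in> Uq_vee q" if "Uq_gen q l \<in> ?S" for d l
    using that S unfolding Uq_def is_subalgebra_presented_algebra_iff by blast
  have sigma_comb: "sigma q a (?comb d l)
      = (d \<odot>\<^bsub>Uq q\<^esub> sigma q a (Uq_gen q l)) \<oplus>\<^bsub>Uq q\<^esub> ((1 - d) \<odot>\<^bsub>Uq q\<^esub> Uq_gen q Gyinv)" for d l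
  proof -
    have "Uq_gen q m \<in> carrier (Uq q)" "e \<odot>\<^bsub>Uq q\<^esub> Uq_gen q m \<in> carrier (Uq q)" for e m
      by (simp_all add: Uq_gen_def Uq_def)
    with s show ?thesis
      unfolding algebra_automorphism_def linear_bijection_def by simp
  qed
  \<comment> \<open>These preimages of \<open>x\<close> and \<open>z\<close> are their images under
    the substitution for \<open>inverse c\<close>, and are combinations of generators of the
    subalgebra.\<close>
  have "sigma q a (?comb c Gx) = Uq_gen q Gx" "sigma q a (?comb (inverse c) Gz) = Uq_gen q Gz"
    using s c by (simp_all add: sigma_comb flip: c_def)
      (simp_all add: Uq_def Uq_gen_def scale_affine_cancel flip: scale_def)
  then have "?S \<subseteq> sigma q a ` Uq_vee q"
    using s comb[of Gx c] comb[of Gz "inverse c"] S by (auto intro: rev_image_eqI)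
  moreover have "sigma q a ` ?S \<subseteq> Uq_vee q"
    using s comb[of Gx "inverse c"] comb[of Gz c] S by (simp add: c_def)
  ultimately show ?thesis
    using s S_car unfolding Uq_vee_def Uq_def
    by (intro image_generated_subalgebra) auto
qed

text \<open>Invariance is equality of the image with the subalgebra, not just inclusion, and so
  passes directly to the composite.\<close>

theorem lemma10p16:
  fixes q a :: "'f::field"
  assumes "q \<noteq> 0" and "q ^ 4 \<noteq> 1"
    and "a \<noteq> 0" and "a ^ 2 \<noteq> 1"
  shows "tau q ` Uq_vee q = Uq_vee q
    \<and> dagger q a ` Uq_vee q = Uq_vee q
    \<and> sigma q a ` Uq_vee q = Uq_vee q"
proof -
  \<comment> \<open>This is the denominator in the relations; it vanishes only if
    \<open>q^2 = 1\<close>.\<close>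
  have "q - inverse q \<noteq> 0"
  proof
    assume "q - inverse q = 0"
    then have "q\<^sup>2 = 1" using \<open>q \<noteq> 0\<close> by (simp add: field_simps power2_eq_square)
    then have "q ^ 4 = 1" using power_mult[of q 2 2] by simp
    with \<open>q ^ 4 \<noteq> 1\<close> show False ..
  qed
  then show ?thesis
    using tau_image[of q] sigma_image[of q a] \<open>a \<noteq> 0\<close>
    unfolding dagger_def image_comp[symmetric] by simp
qed

end
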